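(* Let $m,n,\ell$ be integers such that $m\ge 1$, $n\ge 4$ is even, $0\le\ell\le n/2$ and $\ell\equiv m\pmod 2$, and let $X=\mathrm{HTG}(m,n,\ell)$. Then $X$ is a 3-RDR graph if and only if either $m$ is even and $n\equiv\ell\equiv 0\pmod 6$, or $m$ is odd, $n\equiv 0\pmod 6$ and $\ell\equiv 3\pmod 6$.
   Context: All graphs are finite and simple. For a graph $G=(V,E)$, $N(v)$ is the open neighbourhood of $v$. A $3$-rainbow dominating function (3-RDF) on $G$ is a map $f\colon V\to 2^{\{1,2,3\}}$ such that $f(v)=\emptyset$ implies $\bigcup_{u\in N(v)}f(u)=\{1,2,3\}$, for all $v\in V$; $\gamma_{r3}(G)$ is the minimum of $\sum_{v}|f(v)|$ over all 3-RDFs. A cubic (3-regular) graph $G$ is 3-RDR (3-rainbow domination regular) if $\gamma_{r3}(G)=|V|/2$ (the known lower bound for cubic graphs). For integers $m\ge1$, even $n\ge4$, and $0\le\ell\le n/2$ with $\ell\equiv m\pmod 2$, the honeycomb toroidal graph $\mathrm{HTG}(m,n,\ell)$ has vertex set $\{v_{i,j}: i\in\mathbb Z_m, j\in\mathbb Z_n\}$ and edge set the disjoint union of: vertical edges $\{v_{i,j},v_{i,j+1}\}$ for $i\in\mathbb Z_m$, $j\in\mathbb Z_n$; horizontal edges $\{v_{i,j},v_{i+1,j}\}$ for $i\in\mathbb Z_m\setminus\{m-1\}$, $j\in\mathbb Z_n$, $i+1\equiv j\pmod 2$; and jumps $\{v_{m-1,j},v_{0,j+\ell}\}$ for $j\in\mathbb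 Z_n$, $j\equiv m\pmod 2$. *)

theory Defs
  imports Complex_Main "HOL-Number_Theory.Cong"
begin

text \<open>
  A graph is a pair of a vertex set and a set of two-element vertex sets.
\<close>

type_synonym 'a ugraph = "'a set \<times> 'a set set"

abbreviation uverts :: "'a ugraph \<Rightarrow> 'a set" where
  "uverts G \<equiv> fst G"

abbreviation uedges :: "'a ugraph \<Rightarrow> 'a set set" where
  "uedges G \<equiv> snd G"

definition finite_simple_graph :: "'a ugraph \<Rightarrow> bool" where
  "finite_simple_graph G \<longleftrightarrow>
     finite (uverts G) \<and> (\<forall>e\<in>uedges G. e \<subseteq> uverts G \<and> card e = 2)"

definition open_nbhd :: "'a ugraph \<Rightarrow> 'a \<Rightarrow> 'a set" where
  "open_nbhd G v = {u \<in> uverts G. {u, v} \<in> uedges G}"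

definition cubic_graph :: "'a ugraph \<Rightarrow> bool" where
  "cubic_graph G \<longleftrightarrow>
     finite_simple_graph G \<and> (\<forall>v\<in>uverts G. card (open_nbhd G v) = 3)"

text \<open>
  Functions are total in HOL; the values of \<open>f\<close> outside the vertex set are
  irrelevant both here and in the weight.
\<close>

definition is_3RDF :: "'a ugraph \<Rightarrow> ('a \<Rightarrow> nat set) \<Rightarrow> bool" where
  "is_3RDF G f \<longleftrightarrow>
     (\<forall>v\<in>uverts G. f v \<subseteq> {1, 2, 3}) \<and>
     (\<forall>v\<in>uverts G. f v = {} \<longrightarrow> (\<Union>u\<in>open_nbhd G v. f u) = {1, 2, 3})"

definition rdf_weight :: "'a ugraph \<Rightarrow> ('a \<Rightarrow> nat set) \<Rightarrow> nat" where
  "rdf_weight G f = (\<Sum>v\<in>uverts G. card (f v))"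

text \<open>
  The minimum is always attained: the constant function with value
  \<open>{1, 2, 3}\<close> is a 3-rainbow dominating function.
\<close>

definition gamma_r3 :: "'a ugraph \<Rightarrow> nat" where
  "gamma_r3 G = (LEAST w. \<exists>f. is_3RDF G f \<and> rdf_weight G f = w)"

definition is_3RDR :: "'a ugraph \<Rightarrow> bool" where
  "is_3RDR G \<longleftrightarrow>
     cubic_graph G \<and> real (gamma_r3 G) = real (card (uverts G)) / 2"

text \<open>
  Honeycomb toroidal graphs. The vertex \<open>v\<^sub>i\<^sub>,\<^sub>j\<close> is the pair \<open>(i, j)\<close>, where \<open>\<int>\<^sub>m\<close> and
  \<open>\<int>\<^sub>n\<close> are represented by \<open>{0..<m}\<close> and \<open>{0..<n}\<close>; parities of second
  coordinates are well defined because \<open>n\<close> is even. The three kinds of edges are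
  collected in a set, so for \<open>m = 1\<close>, \<open>l = 1\<close>, where every jump coincides with a
  vertical edge, the graph is a cycle of length \<open>n\<close> and is not cubic.
\<close>

definition HTG_vertical :: "nat \<Rightarrow> nat \<Rightarrow> (nat \<times> nat) set set" where
  "HTG_vertical m n = {{(i, j), (i, (j + 1) mod n)} | i j. i < m \<and> j < n}"

definition HTG_horizontal :: "nat \<Rightarrow> nat \<Rightarrow> (nat \<times> nat) set set" where
  "HTG_horizontal m n =
     {{(i, j), (i + 1, j)} | i j. i < m - 1 \<and> j < n \<and> [i + 1 = j] (mod 2)}"

definition HTG_jumps :: "nat \<Rightarrow> nat \<Rightarrow> nat \<Rightarrow> (nat \<times> nat) set set" where
  "HTG_jumps m n l = {{(m - 1, j), (0, (j + l) mod n)} | j. j < n \<and> [j = m] (mod 2)}"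

definition HTG :: "nat \<Rightarrow> nat \<Rightarrow> nat \<Rightarrow> (nat \<times> nat) ugraph" where
  "HTG m n l =
     ({0..<m} \<times> {0..<n}, HTG_vertical m n \<union> HTG_horizontal m n \<union> HTG_jumps m n l)"

end

theory Submission
  imports Defs
begin

text \<open>
  Double counting the pairs of an empty vertex and a coloured neighbour shows that a 3-rainbow
  dominating function \<open>f\<close> of weight \<open>|V|/2\<close> on a cubic graph takes only empty and one-element
  values, that a coloured vertex has only empty neighbours, and hence that the three neighbours
  of an empty vertex carry the three different colours. Lifted to the hexagonal grid covering
  \<open>HTG(m,n,l)\<close>, such an \<open>f\<close> is a proper 3-colouring of a triangular lattice, which is unique up
  to renaming the colours: it depends only on \<open>j mod 3\<close> (and on the parity of \<open>i + j\<close>). It is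
  invariant under the deck transformations exactly if 3 divides \<open>n\<close> and \<open>l\<close>. Conversely,
  the colouring by \<open>j mod 3\<close> even separates the neighbours of every vertex, which also shows
  that the graph is cubic.
\<close>

section \<open>Weights of 3-rainbow dominating functions on cubic graphs\<close>

lemma cubic_graphD:
  assumes "cubic_graph G"
  shows "finite (uverts G)" "\<And>v. finite (open_nbhd G v)"
    "\<And>v. v \<in> uverts G \<Longrightarrow> card (open_nbhd G v) = 3"
  using assms by (auto simp: cubic_graph_def finite_simple_graph_def open_nbhd_def)

lemma open_nbhd_sym:
  "u \<in> uverts G \<Longrightarrow> v \<in> uverts G \<Longrightarrow> u \<in> open_nbhd G v \<longleftrightarrow> v \<in> open_nbhd G u"
  by (simp add: open_nbhd_def insert_commute)

text \<open>Let \<open>Z\<close> be the set of empty vertices and \<open>w\<close> the weight. Each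
  vertex of \<open>Z\<close> receives weight at least 3 from its neighbours, and a coloured vertex u
  contributes at most 3 |f u| to these totals, so |Z| \<le> w. Adding |V - Z| \<le> w gives the
  bound. If |V| = 2 w, both estimates are sharp, and the local conclusions are their termwise
  equality cases.\<close>

lemma cubic_3RDF_weight:
  assumes G: "cubic_graph G" and f: "is_3RDF G f"
  shows "card (uverts G) \<le> 2 * rdf_weight G f"
    and "\<lbrakk>card (uverts G) = 2 * rdf_weight G f; v \<in> uverts G; f v \<noteq> {}\<rbrakk>
      \<Longrightarrow> card (f v) = 1 \<and> (\<forall>u\<in>open_nbhd G v. f u = {})"
proof -
  define V Z w where "V = uverts G" and "Z = {v \<in> V. f v = {}}" and "w = rdf_weight G f"
  note fin = cubic_graphD[OF G]
  have finV: "finite V" and finZ: "finite Z" using fin by (auto simp: V_def Z_def)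
  have finf: "finite (f u)" if "u \<in> V" for u
    using f that by (auto simp: is_3RDF_def V_def intro: finite_subset)
  have nonempty: "1 \<le> card (f u)" if "u \<in> V - Z" for u
    using that finf[of u] by (auto simp: Z_def Suc_le_eq card_gt_0_iff)
  have w: "w = (\<Sum>u\<in>V - Z. card (f u))"
    unfolding w_def rdf_weight_def V_def[symmetric]
    by (rule sum.mono_neutral_right) (auto simp: finV Z_def)
  have le1: "card (V - Z) \<le> w"
    unfolding w using sum_mono[of "V - Z" "\<lambda>_. 1" "\<lambda>u. card (f u)"] nonempty by simp
  have three: "3 \<le> (\<Sum>u\<in>open_nbhd G v. card (f u))" if "v \<in> Z" for v
  proof -
    have "(\<Union>u\<in>open_nbhd G v. f u) = {1, 2, 3}"
      using f that by (auto simp: is_3RDF_def V_def Z_def)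
    then have "card (\<Union>u\<in>open_nbhd G v. f u) = 3" by simp
    with card_UN_le[OF fin(2)[of v], of f] show ?thesis by simp
  qed
  have deg: "card (f u) * card (open_nbhd G u \<inter> Z) \<le> 3 * card (f u)" if "u \<in> V - Z" for u
    using fin(3)[of u] that card_mono[OF fin(2)[of u], of "open_nbhd G u \<inter> Z"]
    by (simp add: V_def)
  have "3 * card Z \<le> (\<Sum>v\<in>Z. \<Sum>u\<in>open_nbhd G v. card (f u))"
    using sum_mono[of Z "\<lambda>_. 3" "\<lambda>v. \<Sum>u\<in>open_nbhd G v. card (f u)"] three by simp
  \<comment> \<open>Empty neighbours contribute 0, so the inner sum may run over the fixed set
    \<open>V - Z\<close>, which permits exchanging the sums.\<close>
  also have "\<dots> = (\<Sum>v\<in>Z. \<Sum>u\<in>V - Z. if u \<in> open_nbhd G v then card (f u) else 0)"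
  proof (rule sum.cong[OF refl])
    fix v
    have "(\<Sum>u\<in>V - Z. if u \<in> open_nbhd G v then card (f u) else 0)
        = (\<Sum>u\<in>(V - Z) \<inter> open_nbhd G v. card (f u))"
      by (rule sum.inter_restrict[symmetric]) (use finV in auto)
    also have "\<dots> = (\<Sum>u\<in>open_nbhd G v. card (f u))"
      by (rule sum.mono_neutral_left) (auto simp: fin Z_def V_def open_nbhd_def)
    finally show "(\<Sum>u\<in>open_nbhd G v. card (f u)) =
        (\<Sum>u\<in>V - Z. if u \<in> open_nbhd G v then card (f u) else 0)" by simp
  qed
  also have "\<dots> = (\<Sum>u\<in>V - Z. \<Sum>v\<in>Z. if u \<in> open_nbhd G v then card (f u) else 0)"
    by (rule sum.swap)
  also have "\<dots> = (\<Sum>u\<in>V - Z. card (f u) * card (open_nbhd G u \<inter> Z))"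
  proof (rule sum.cong[OF refl])
    fix u assume u: "u \<in> V - Z"
    have "(\<Sum>v\<in>Z. if u \<in> open_nbhd G v then card (f u) else 0)
        = (\<Sum>v\<in>Z. if v \<in> open_nbhd G u then card (f u) else 0)"
      using u by (intro sum.cong) (auto simp: Z_def V_def open_nbhd_sym)
    also have "\<dots> = (\<Sum>v\<in>Z \<inter> open_nbhd G u. card (f u))"
      by (rule sum.inter_restrict[symmetric]) (use finZ in auto)
    finally show "(\<Sum>v\<in>Z. if u \<in> open_nbhd G v then card (f u) else 0)
        = card (f u) * card (open_nbhd G u \<inter> Z)" by (simp add: Int_commute)
  qed
  finally have Zle: "3 * card Z \<le> (\<Sum>u\<in>V - Z. card (f u) * card (open_nbhd G u \<inter> Z))" .
  have wle: "(\<Sum>u\<in>V - Z. card (f u) * card (open_nbhd G u \<inter> Z)) \<le> 3 * w"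
    unfolding w sum_distrib_left by (rule sum_mono[OF deg])
  have V: "card V = card Z + card (V - Z)"
    using finV by (subst card_Diff_subset) (auto simp: Z_def card_mono finZ[unfolded Z_def])
  show "card (uverts G) \<le> 2 * rdf_weight G f"
    using Zle wle le1 V unfolding V_def w_def by linarith
  assume "card (uverts G) = 2 * rdf_weight G f" and v: "v \<in> uverts G" "f v \<noteq> {}"
  then have eq: "card (V - Z) = w"
    "(\<Sum>u\<in>V - Z. card (f u) * card (open_nbhd G u \<inter> Z)) = 3 * w"
    using Zle wle le1 V unfolding V_def w_def by linarith+
  have vVZ: "v \<in> V - Z" using v by (simp add: V_def Z_def)
  \<comment> \<open>Equal sums with termwise inequalities have equal terms. This is applied first to
    the bound \<open>nonempty\<close> and then to the bound \<open>deg\<close>.\<close>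
  have "(\<Sum>u\<in>V - Z. 1) = (\<Sum>u\<in>V - Z. card (f u))"
    using eq(1) w by simp
  from sum_mono_inv[OF this nonempty vVZ] have 1: "card (f v) = 1"
    using finV by simp
  have "(\<Sum>u\<in>V - Z. card (f u) * card (open_nbhd G u \<inter> Z)) = (\<Sum>u\<in>V - Z. 3 * card (f u))"
    using eq(2) w by (simp add: sum_distrib_left)
  from sum_mono_inv[OF this deg vVZ] have "card (open_nbhd G v \<inter> Z) = 3"
    using finV 1 by simp
  then have "open_nbhd G v \<inter> Z = open_nbhd G v"
    using fin v by (intro card_subset_eq) auto
  with 1 show "card (f v) = 1 \<and> (\<forall>u\<in>open_nbhd G v. f u = {})"
    by (auto simp: Z_def)
qed

text \<open>No weight is below half the order, so the minimum equals this half as soon as some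
  function attains it. The constant function \<open>{1, 2, 3}\<close> shows that the
  \<open>LEAST\<close> ranges over a nonempty set and is therefore attained.\<close>

lemma is_3RDR_iff:
  "is_3RDR G \<longleftrightarrow> cubic_graph G \<and> (\<exists>f. is_3RDF G f \<and> card (uverts G) = 2 * rdf_weight G f)"
proof (cases "cubic_graph G")
  case True
  let ?P = "\<lambda>w. \<exists>f. is_3RDF G f \<and> rdf_weight G f = w"
  have nonempty: "open_nbhd G v \<noteq> {}" if "v \<in> uverts G" for v
    using cubic_graphD(3)[OF True that] by auto
  have "is_3RDF G (\<lambda>_. {1, 2, 3})"
    using nonempty by (simp add: is_3RDF_def)
  then have "?P (rdf_weight G (\<lambda>_. {1, 2, 3}))" by blast
  then have attained: "?P (gamma_r3 G)" unfolding gamma_r3_def by (rule LeastI)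
  have least: "gamma_r3 G \<le> rdf_weight G f" if "is_3RDF G f" for f
    unfolding gamma_r3_def by (rule Least_le) (use that in blast)
  have half: "real (gamma_r3 G) = real (card (uverts G)) / 2 \<longleftrightarrow> card (uverts G) = 2 * gamma_r3 G"
    by linarith
  have "card (uverts G) = 2 * gamma_r3 G \<longleftrightarrow>
      (\<exists>f. is_3RDF G f \<and> card (uverts G) = 2 * rdf_weight G f)"
    using attained least cubic_3RDF_weight(1)[OF True]
    by (metis le_antisym mult_le_mono2)
  with True half show ?thesis by (simp add: is_3RDR_def)
qed (simp add: is_3RDR_def)

section \<open>The covering of the honeycomb toroidal graph by the hexagonal grid\<close>

text \<open>
  The projection to the honeycomb toroidal graph from its covering by the plane hexagonal grid
  on \<open>\<int> \<times> \<int>\<close>: moving right by \<open>m\<close> columns is identified with moving up by \<open>l\<close>.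
\<close>

definition htg_proj :: "nat \<Rightarrow> nat \<Rightarrow> nat \<Rightarrow> int \<Rightarrow> int \<Rightarrow> nat \<times> nat" where
  "htg_proj m n l i j = (nat (i mod int m), nat ((j + int l * (i div int m)) mod int n))"

lemma htg_proj_int: "i < m \<Longrightarrow> j < n \<Longrightarrow> htg_proj m n l (int i) (int j) = (i, j)"
  by (simp add: htg_proj_def)

text \<open>If one of the sets were empty or two of them agreed, two sets with at most one element
  each would cover three colours.\<close>

lemma rainbow_union:
  fixes A B C :: "nat set"
  assumes "A \<union> B \<union> C = {1, 2, 3}" "card A \<le> 1" "card B \<le> 1" "card C \<le> 1"
  shows "A \<noteq> {}" "B \<noteq> {}" "C \<noteq> {}" "A \<noteq> B" "A \<noteq> C" "B \<noteq> C"
proof -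
  have two: "S \<union> T \<noteq> {1, 2, 3}" if "card S \<le> 1" "card T \<le> 1" for S T :: "nat set"
  proof
    assume "S \<union> T = {1, 2, 3}"
    then have "card (S \<union> T) = 3" by simp
    with card_Un_le[of S T] that show False by simp
  qed
  show "A \<noteq> {}" by (rule notI) (use assms(1) two[OF assms(3,4)] in simp)
  show "B \<noteq> {}" by (rule notI) (use assms(1) two[OF assms(2,4)] in simp)
  show "C \<noteq> {}" by (rule notI) (use assms(1) two[OF assms(2,3)] in simp)
  show "A \<noteq> B" by (rule notI) (use assms(1) two[OF assms(3,4)] in simp)
  show "A \<noteq> C" by (rule notI) (use assms(1) two[OF assms(3,4)] in \<open>simp add: Un_ac\<close>)
  show "B \<noteq> C" by (rule notI) (use assms(1) two[OF assms(2,4)] in \<open>simp add: Un_ac\<close>)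
qed

text \<open>Three pairwise different elements exhaust \<open>{p, q, r}\<close>. This identifies a
  colour once the two others are excluded.\<close>

lemma third_colour:
  assumes "a \<in> {p, q, r}" "b \<in> {p, q, r}" "c \<in> {p, q, r}" "x \<in> {p, q, r}"
    and "b \<noteq> a" "c \<noteq> a" "c \<noteq> b" "x \<noteq> b" "x \<noteq> c"
  shows "x = a"
  using assms by blast

locale htg =
  fixes m n l :: nat
  assumes m: "m \<ge> 1" and n: "n \<ge> 4" and even_n: "even n" and l: "[l = m] (mod 2)"
begin

abbreviation "p \<equiv> htg_proj m n l"
abbreviation "X \<equiv> HTG m n l"

text \<open>Direction of the single non-vertical edge at a grid vertex: such edges run to the right
  from the vertices with i + j odd and reach the remaining vertices from the left.\<close>

definition side :: "int \<Rightarrow> int \<Rightarrow> int" where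
  "side i j = (if odd (i + j) then 1 else -1)"

lemma parity_l: "even l \<longleftrightarrow> even m"
  using l by (auto simp: cong_def even_iff_mod_2_eq_zero)

lemma proj_verts: "p i j \<in> uverts X"
  using m n by (auto simp: htg_proj_def HTG_def nat_less_iff)

lemma vertsE:
  assumes "v \<in> uverts X"
  obtains i j where "v = p i j"
proof -
  obtain a b where "v = (a, b)" "a < m" "b < n"
    using assms by (auto simp: HTG_def)
  then have "v = p (int a) (int b)" by (simp add: htg_proj_int)
  then show ?thesis by (rule that)
qed

lemma proj_eq_iff:
  "p i j = p i' j' \<longleftrightarrow> i mod int m = i' mod int m \<and>
     (j + int l * (i div int m)) mod int n = (j' + int l * (i' div int m)) mod int n"
  using m n by (simp add: htg_proj_def eq_nat_nat_iff)

lemma proj_shift_column: "p (i + int m) j = p i (j + int l)"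
  using m by (simp add: proj_eq_iff algebra_simps)

lemma proj_period: "p i (j + int n) = p i j"
proof -
  have "(j + int n + int l * (i div int m)) mod int n = (j + int l * (i div int m) + int n) mod int n"
    by (simp add: algebra_simps)
  then show ?thesis by (simp add: proj_eq_iff)
qed

text \<open>Two grid points with the same image differ by a vector (q m, k n - q l). Translations
  commute with adding such a vector, and its coordinate sum is even because n is even and l has the
  parity of m.\<close>

lemma proj_eq_translate:
  assumes "p i j = p i' j'"
  shows "p (i + a) (j + b) = p (i' + a) (j' + b)" "even (i + j) \<longleftrightarrow> even (i' + j')"
proof -
  define M N L where "M = int m" and "N = int n" and "L = int l"
  have M: "M > 0" using m by (simp add: M_def)
  have "i mod M = i' mod M" using assms by (simp add: proj_eq_iff M_def)
  then obtain q where q: "i = i' + q * M"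
    by (metis mod_eqE mult.commute)
  have div: "(i' + c + q * M) div M = (i' + c) div M + q" for c
    using M by simp
  have "(j + L * (i div M)) mod N = (j' + L * (i' div M)) mod N"
    using assms by (simp add: proj_eq_iff M_def L_def N_def)
  then have "N dvd (j + L * (i div M)) - (j' + L * (i' div M))"
    by (simp add: mod_eq_dvd_iff)
  then have dvd: "N dvd j - j' + L * q"
    using div[of 0] q by (simp add: algebra_simps)
  have ia: "i + a = i' + a + q * M" using q by simp
  have "(i + a) div M = (i' + a) div M + q" "(i + a) mod M = (i' + a) mod M"
    unfolding ia by (rule div) simp
  moreover have "N dvd (j + b + L * ((i' + a) div M + q)) - (j' + b + L * ((i' + a) div M))"
    using dvd by (simp add: algebra_simps)
  ultimately show "p (i + a) (j + b) = p (i' + a) (j' + b)"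
    unfolding proj_eq_iff M_def[symmetric] N_def[symmetric] L_def[symmetric] mod_eq_dvd_iff
    by (simp only: simp_thms)
  have "even N" "even L \<longleftrightarrow> even M"
    using even_n parity_l by (simp_all add: N_def M_def L_def)
  then show "even (i + j) \<longleftrightarrow> even (i' + j')"
    using dvd dvd_trans[of 2 N "j - j' + L * q"] unfolding q by auto
qed

lemma vertical_edge_iff:
  "e \<in> HTG_vertical m n \<longleftrightarrow> (\<exists>i j. e = {p i j, p i (j + 1)})"
proof
  assume "e \<in> HTG_vertical m n"
  then obtain a b where e: "e = {(a, b), (a, (b + 1) mod n)}" "a < m" "b < n"
    by (auto simp: HTG_vertical_def)
  then have "p (int a) (int b) = (a, b)" "p (int a) (int b + 1) = (a, (b + 1) mod n)"
    by (simp_all add: htg_proj_def nat_mod_distrib nat_add_distrib)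
  with e show "\<exists>i j. e = {p i j, p i (j + 1)}" by metis
next
  assume "\<exists>i j. e = {p i j, p i (j + 1)}"
  then obtain i j where e: "e = {p i j, p i (j + 1)}" by blast
  obtain a b where ab: "p i j = (a, b)" by fastforce
  with proj_verts[of i j] have lt: "a < m" "b < n" by (auto simp: HTG_def)
  then have "p i j = p (int a) (int b)" by (simp add: ab htg_proj_int)
  from proj_eq_translate(1)[OF this, of 0 1] have "p i (j + 1) = p (int a) (int b + 1)" by simp
  also have "\<dots> = (a, (b + 1) mod n)"
    using lt by (simp add: htg_proj_def nat_mod_distrib nat_add_distrib)
  finally show "e \<in> HTG_vertical m n"
    using lt e ab by (auto simp: HTG_vertical_def)
qed

lemma proj_right:
  assumes "a < m" "b < n"
  shows "p (int a + 1) (int b) = (if a < m - 1 then (a + 1, b) else (0, (b + l) mod n))"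
proof (cases "a < m - 1")
  case True
  then show ?thesis using assms htg_proj_int[of "a + 1" m b n l] by (simp add: add.commute)
next
  case False
  then have "int a + 1 = 0 + int m" using assms by simp
  then have "p (int a + 1) (int b) = p 0 (int b + int l)"
    by (simp only: proj_shift_column)
  then show ?thesis
    using False by (simp add: htg_proj_def nat_mod_distrib nat_add_distrib)
qed

text \<open>The jumps are the horizontal edges leaving column m - 1: there i + j is odd exactly if j
  has the parity of m, and arriving in column m means arriving in column 0, raised by l.\<close>

lemma cross_edge_iff:
  "e \<in> HTG_horizontal m n \<union> HTG_jumps m n l \<longleftrightarrow> (\<exists>i j. odd (i + j) \<and> e = {p i j, p (i + 1) j})"
proof
  assume "e \<in> HTG_horizontal m n \<union> HTG_jumps m n l"
  then obtain a b where e: "a < m" "b < n" "odd (a + b)"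
      "e = {(a, b), if a < m - 1 then (a + 1, b) else (0, (b + l) mod n)}"
  proof
    assume "e \<in> HTG_horizontal m n"
    then obtain a b where "e = {(a, b), (a + 1, b)}" "a < m - 1" "b < n" "[a + 1 = b] (mod 2)"
      by (auto simp: HTG_horizontal_def)
    moreover from this have "odd (a + b)" unfolding cong_def by presburger
    ultimately show ?thesis using that[of a b] by simp
  next
    assume "e \<in> HTG_jumps m n l"
    then obtain b where "e = {(m - 1, b), (0, (b + l) mod n)}" "b < n" "[b = m] (mod 2)"
      by (auto simp: HTG_jumps_def)
    moreover from this have "odd (m - 1 + b)" using m unfolding cong_def by presburger
    ultimately show ?thesis using that[of "m - 1" b] m by simp
  qed
  then have "odd (int a + int b)" "e = {p (int a) (int b), p (int a + 1) (int b)}"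
    by (simp_all add: htg_proj_int proj_right)
  then show "\<exists>i j. odd (i + j) \<and> e = {p i j, p (i + 1) j}" by blast
next
  assume "\<exists>i j. odd (i + j) \<and> e = {p i j, p (i + 1) j}"
  then obtain i j where e: "odd (i + j)" "e = {p i j, p (i + 1) j}" by blast
  obtain a b where ab: "p i j = (a, b)" by fastforce
  with proj_verts[of i j] have lt: "a < m" "b < n" by (auto simp: HTG_def)
  then have eq: "p i j = p (int a) (int b)" by (simp add: ab htg_proj_int)
  have odd: "odd (a + b)" using proj_eq_translate(2)[OF eq] e(1) by simp
  have "p (i + 1) j = p (int a + 1) (int b)" using proj_eq_translate(1)[OF eq, of 1 0] by simp
  then have e': "e = {(a, b), if a < m - 1 then (a + 1, b) else (0, (b + l) mod n)}"
    using e ab lt by (simp add: proj_right)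
  show "e \<in> HTG_horizontal m n \<union> HTG_jumps m n l"
  proof (cases "a < m - 1")
    case True
    moreover have "[a + 1 = b] (mod 2)" using odd unfolding cong_def by presburger
    ultimately show ?thesis using e' lt by (auto simp: HTG_horizontal_def)
  next
    case False
    then have a: "a = m - 1" using lt by simp
    then have "[b = m] (mod 2)" using odd m unfolding cong_def by presburger
    then show ?thesis using e' lt a by (auto simp: HTG_jumps_def)
  qed
qed

lemma edge_iff:
  "e \<in> uedges X \<longleftrightarrow> (\<exists>i j. e = {p i j, p i (j + 1)} \<or> odd (i + j) \<and> e = {p i j, p (i + 1) j})"
  using vertical_edge_iff[of e] cross_edge_iff[of e] by (auto simp: HTG_def)

text \<open>An edge at \<open>p i j\<close> may be given through another preimage of this vertex;
  \<open>proj_eq_translate\<close> moves it back to (i, j) and keeps its direction. The three listed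
  vertices can coincide, as for m = l = 1.\<close>

lemma nbhd_proj: "open_nbhd X (p i j) = {p i (j + 1), p i (j - 1), p (i + side i j) j}"
proof (intro equalityI subsetI)
  fix u assume "u \<in> open_nbhd X (p i j)"
  then have "{u, p i j} \<in> uedges X" by (simp add: open_nbhd_def)
  then obtain i' j' where
    "{u, p i j} = {p i' j', p i' (j' + 1)} \<or> odd (i' + j') \<and> {u, p i j} = {p i' j', p (i' + 1) j'}"
    unfolding edge_iff by blast
  then consider (up) "u = p i' (j' + 1)" "p i' j' = p i j"
    | (down) "u = p i' j'" "p i' (j' + 1) = p i j"
    | (right) "odd (i' + j')" "u = p (i' + 1) j'" "p i' j' = p i j"
    | (left) "odd (i' + j')" "u = p i' j'" "p (i' + 1) j' = p i j"
    by (auto simp: doubleton_eq_iff)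
  then show "u \<in> {p i (j + 1), p i (j - 1), p (i + side i j) j}"
  proof cases
    case up
    then show ?thesis using proj_eq_translate(1)[OF up(2), of 0 1] by simp
  next
    case down
    then show ?thesis using proj_eq_translate(1)[OF down(2), of 0 "-1"] by simp
  next
    case right
    then show ?thesis
      using proj_eq_translate(1)[OF right(3), of 1 0] proj_eq_translate(2)[OF right(3)]
      by (simp add: side_def)
  next
    case left
    then show ?thesis
      using proj_eq_translate(1)[OF left(3), of "-1" 0] proj_eq_translate(2)[OF left(3)]
      by (simp add: side_def)
  qed
next
  fix u assume "u \<in> {p i (j + 1), p i (j - 1), p (i + side i j) j}"
  then consider "u = p i (j + 1)" | "u = p i (j - 1)" | "u = p (i + side i j) j" by blast
  then have "{u, p i j} \<in> uedges X"
  proof cases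
    case 1
    then show ?thesis unfolding edge_iff by (metis insert_commute)
  next
    case 2
    then show ?thesis unfolding edge_iff by (metis diff_add_cancel)
  next
    case 3
    show ?thesis
    proof (cases "odd (i + j)")
      case True
      then have "{u, p i j} = {p i j, p (i + 1) j}" using 3 by (auto simp: side_def)
      then show ?thesis unfolding edge_iff using True by blast
    next
      case False
      then have "odd ((i - 1) + j)" "{u, p i j} = {p (i - 1) j, p (i - 1 + 1) j}"
        using 3 by (auto simp: side_def)
      then show ?thesis unfolding edge_iff by blast
    qed
  qed
  moreover have "u \<in> uverts X"
    using \<open>u \<in> {p i (j + 1), p i (j - 1), p (i + side i j) j}\<close> proj_verts by auto
  ultimately show "u \<in> open_nbhd X (p i j)" by (simp add: open_nbhd_def)
qed

section \<open>Necessity of the divisibility conditions\<close>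

text \<open>The lift \<open>g\<close> is invariant under translation by (0, n) and by (m, -l). In a
  column, a colour recurs exactly at multiples of 6, and each column change along a suitable walk
  shifts the pattern by 3. Comparing the two yields the divisibilities.\<close>

lemma divisible_if_3RDR:
  assumes "is_3RDR X"
  shows "6 dvd n" "3 dvd l"
proof -
  from assms obtain f where cubic: "cubic_graph X" and f: "is_3RDF X f"
    and half: "card (uverts X) = 2 * rdf_weight X f"
    by (auto simp: is_3RDR_iff)
  define g where "g i j = f (p i j)" for i j
  have single: "card (g i j) = 1 \<and> g i (j + 1) = {} \<and> g i (j - 1) = {} \<and> g (i + side i j) j = {}"
    if "g i j \<noteq> {}" for i j
    using cubic_3RDF_weight(2)[OF cubic f half proj_verts, of i j] that
    by (auto simp: g_def nbhd_proj)
  have colour: "g i j \<in> {{1}, {2}, {3}}" if ne: "g i j \<noteq> {}" for i j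
  proof -
    obtain c where "g i j = {c}" using single[OF ne] by (auto simp: card_1_singleton_iff)
    moreover have "g i j \<subseteq> {1, 2, 3}" using f proj_verts by (simp add: g_def is_3RDF_def)
    ultimately show ?thesis by auto
  qed
  have rainbow: "g i (j + 1) \<noteq> {}" "g i (j - 1) \<noteq> {}" "g (i + side i j) j \<noteq> {}"
    "g i (j + 1) \<noteq> g i (j - 1)" "g i (j + 1) \<noteq> g (i + side i j) j"
    "g i (j - 1) \<noteq> g (i + side i j) j" if "g i j = {}" for i j
  proof -
    have "(\<Union>u\<in>open_nbhd X (p i j). f u) = {1, 2, 3}"
      using f that proj_verts[of i j] by (simp add: is_3RDF_def g_def)
    then have union: "g i (j + 1) \<union> g i (j - 1) \<union> g (i + side i j) j = {1, 2, 3}"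
      by (simp add: g_def nbhd_proj Un_assoc)
    have le: "card (g i' j') \<le> 1" for i' j'
      using single[of i' j'] by (cases "g i' j' = {}") simp_all
    show "g i (j + 1) \<noteq> {}" "g i (j - 1) \<noteq> {}" "g (i + side i j) j \<noteq> {}"
      "g i (j + 1) \<noteq> g i (j - 1)" "g i (j + 1) \<noteq> g (i + side i j) j"
      "g i (j - 1) \<noteq> g (i + side i j) j"
      by (fact rainbow_union[OF union le le le])+
  qed
  have alt: "g i (j + 1) = {} \<longleftrightarrow> g i j \<noteq> {}" for i j
    using single[of i j] rainbow(1)[of i j] by blast
  have alt2: "g i (j + 2) = {} \<longleftrightarrow> g i j = {}" for i j
    using alt[of i j] alt[of i "j + 1"] by (simp add: algebra_simps)
  text \<open>
    The three vertices at \<open>j\<close>, \<open>j + 2\<close>, \<open>j + 4\<close> of a column have different colours, since the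
    colours missing on the pairs \<open>j\<close>, \<open>j + 2\<close> and \<open>j + 2\<close>, \<open>j + 4\<close> occur as neighbours of a
    common empty vertex in the next column.
  \<close>
  have step: "g i (j + 2) \<noteq> g i j" "g i (j + 4) \<noteq> g i j" "g i (j + 4) \<noteq> g i (j + 2)"
    "g (i + side i (j + 1)) (j + 3) = g i j"
    if ne: "g i j \<noteq> {}" for i j
  proof -
    define s where "s = side i (j + 1)"
    have s3: "side i (j + 3) = s" by (simp add: s_def side_def)
    have e1: "g i (j + 1) = {}" using alt ne by blast
    have e3: "g i (j + 3) = {}" using alt2[of i "j + 1"] e1 by (simp add: algebra_simps)
    have r1: "g i (j + 2) \<noteq> {}" "g i (j + 2) \<noteq> g i j" "g (i + s) (j + 1) \<noteq> {}"
      "g i (j + 2) \<noteq> g (i + s) (j + 1)" "g i j \<noteq> g (i + s) (j + 1)"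
      using rainbow[OF e1] by (simp_all add: s_def algebra_simps)
    have r3: "g i (j + 4) \<noteq> {}" "g i (j + 4) \<noteq> g i (j + 2)" "g (i + s) (j + 3) \<noteq> {}"
      "g i (j + 4) \<noteq> g (i + s) (j + 3)" "g i (j + 2) \<noteq> g (i + s) (j + 3)"
      using rainbow[OF e3] by (simp_all add: s3 algebra_simps)
    have e2: "g (i + s) (j + 2) = {}"
      using alt[of "i + s" "j + 1"] r1 by (simp add: algebra_simps)
    have r2: "g (i + s) (j + 3) \<noteq> g (i + s) (j + 1)"
      using rainbow(4)[OF e2] by (simp add: algebra_simps)
    show "g i (j + 2) \<noteq> g i j" "g i (j + 4) \<noteq> g i (j + 2)" by (fact r1 r3)+
    \<comment> \<open>The colours at (i, j + 2) and (i + s, j + 1) are the two colours other than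
      \<open>g i j\<close>, and the vertex (i + s, j + 3) avoids both of them.\<close>
    have "g (i + s) (j + 3) = g i j"
      by (rule third_colour[OF colour[OF ne] colour[OF r1(1)] colour[OF r1(3)] colour[OF r3(3)]])
        (use r1 r2 r3 in simp_all)
    then show "g (i + side i (j + 1)) (j + 3) = g i j" "g i (j + 4) \<noteq> g i j"
      using r3 by (simp_all add: s_def)
  qed
  \<comment> \<open>The triples starting at j and at j + 2 both use all three colours and share two
    vertices, so their remaining vertices j and j + 6 agree.\<close>
  have six: "g i (j + 6) = g i j" for i j
  proof (cases "g i j = {}")
    case True
    then show ?thesis using alt2[of i j] alt2[of i "j + 2"] alt2[of i "j + 4"]
      by (simp add: algebra_simps)
  next
    case False
    have 2: "g i (j + 2) \<noteq> {}" using False alt2 by blast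
    have 4: "g i (j + 4) \<noteq> {}" using 2 alt2[of i "j + 2"] by (simp add: algebra_simps)
    have 6: "g i (j + 6) \<noteq> {}" using 4 alt2[of i "j + 4"] by (simp add: algebra_simps)
    have "g i (j + 6) \<noteq> g i (j + 2)" "g i (j + 6) \<noteq> g i (j + 4)"
      using step(2,3)[OF 2] by (simp_all add: algebra_simps)
    with step(1-3)[OF False] show ?thesis
      by (intro third_colour[OF colour[OF False] colour[OF 2] colour[OF 4] colour[OF 6]]) simp_all
  qed
  have six_nat: "g i (j + 6 * int k) = g i j" for i j k
  proof (induction k)
    case (Suc k)
    then show ?case using six[of i "j + 6 * int k"] by (simp add: algebra_simps)
  qed simp
  have six_int: "g i (j + 6 * q) = g i j" for i j q
    using six_nat[of i j "nat q"] six_nat[of i "j + 6 * q" "nat (- q)"]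
    by (cases "q \<ge> 0") simp_all
  \<comment> \<open>Reduce t modulo 6: odd offsets lead to empty vertices, and offsets 2 and 4 to
    the other two colours, so only residue 0 remains.\<close>
  have period: "6 dvd t" if ne: "g i j \<noteq> {}" and t: "g i (j + t) = g i j" for i j t
  proof -
    define r where "r = t mod 6"
    have "j + t = (j + r) + 6 * (t div 6)" by (simp add: r_def)
    then have r: "g i (j + r) = g i j" using six_int t by metis
    have "r \<in> {0..<6}" by (simp add: r_def)
    moreover have "{0..<6} = {0, 1, 2, 3, 4, 5 :: int}" by auto
    moreover have "g i (j + 1) = {}" using alt ne by blast
    moreover from this have "g i (j + 3) = {}" using alt2[of i "j + 1"] by (simp add: algebra_simps)
    moreover from this have "g i (j + 5) = {}" using alt2[of i "j + 3"] by (simp add: algebra_simps)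
    ultimately have "r = 0" using r step[OF ne] ne by auto
    then show ?thesis by (simp add: r_def dvd_eq_mod_eq_0)
  qed
  obtain j where ne: "g 0 j \<noteq> {}" using alt by blast
  define s where "s = side 0 (j + 1)"
  \<comment> \<open>Each step moves one column in direction s and three up. This changes i + j by an
    even amount, so the next step can take the same direction.\<close>
  have walk: "g (s * int k) (j + 3 * int k) = g 0 j \<and> side (s * int k) (j + 3 * int k + 1) = s" for k
  proof (induction k)
    case 0
    then show ?case by (simp add: s_def)
  next
    case (Suc k)
    then have "g (s * int k) (j + 3 * int k) \<noteq> {}" using ne by simp
    from step(4)[OF this] Suc have "g (s * int k + s) (j + 3 * int k + 3) = g 0 j" by simp
    moreover have "side (s * int k + s) (j + 3 * int k + 3 + 1) = side (s * int k) (j + 3 * int k + 1)"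
      by (simp add: side_def s_def)
    ultimately show ?case using Suc by (simp add: algebra_simps)
  qed
  have "6 dvd int n" using period[OF ne, of "int n"] by (simp add: g_def proj_period)
  then show "6 dvd n" by presburger
  have shift: "g (i + int m) j' = g i (j' + int l)" for i j'
    by (simp add: g_def proj_shift_column)
  have s: "s = 1 \<or> s = -1" by (simp add: s_def side_def)
  \<comment> \<open>After m steps the walk has gone once around the torus. For s = 1 its end is
    carried back to column 0; for s = -1 its start is carried to column -m, where the heights j + l
    and j + 3 m are compared.\<close>
  then have "6 dvd 3 * int m + int l \<or> 6 dvd 3 * int m - int l"
  proof
    assume "s = 1"
    then have "g 0 (j + (3 * int m + int l)) = g 0 j"
      using walk[of m] shift[of 0 "j + 3 * int m"] by (simp add: algebra_simps)
    from period[OF ne this] show ?thesis ..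
  next
    assume "s = -1"
    then have *: "g (- int m) (j + 3 * int m) = g 0 j" using walk[of m] by simp
    have **: "g (- int m) (j + int l) = g 0 j" using shift[of "- int m" j] by simp
    have "6 dvd 3 * int m - int l"
    proof (rule period)
      show "g (- int m) (j + int l) \<noteq> {}" using ** ne by simp
      show "g (- int m) (j + int l + (3 * int m - int l)) = g (- int m) (j + int l)"
        using * ** by simp
    qed
    then show ?thesis ..
  qed
  then show "3 dvd l" by presburger
qed

section \<open>Sufficiency: a colouring of weight half the order\<close>

lemma card_even_interval: "card {j \<in> {0..<n}. even (i + j)} = n div 2"
proof -
  have "card {j \<in> {0..<2 * k}. even (i + j)} = k" for k
  proof (induction k)
    case (Suc k)
    have "{j \<in> {0..<2 * Suc k}. even (i + j)} =
        insert (if even i then 2 * k else 2 * k + 1) {j \<in> {0..<2 * k}. even (i + j)}"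
      by (auto simp: less_Suc_eq)
    then show ?case using Suc by simp
  qed simp
  from this[of "n div 2"] even_n show ?thesis by simp
qed

text \<open>The divisibilities make the height modulo 3 well defined on the torus. This residue
  serves twice: it certifies three distinct neighbours at every vertex, and it colours one class of
  the bipartition by the parity of i + j.\<close>

lemma is_3RDR_if_divisible:
  assumes "3 dvd n" "3 dvd l"
  shows "is_3RDR X"
proof -
  define c where "c v = snd v mod 3" for v :: "nat \<times> nat"
  define f where "f v = (if even (fst v + snd v) then {c v + 1} else {})" for v
  have c: "int (c (p i j)) = j mod 3" for i j
  proof -
    have "int (c (p i j)) = (j + int l * (i div int m)) mod int n mod 3"
      using n by (simp add: c_def htg_proj_def zmod_int)
    also have "\<dots> = (j + int l * (i div int m)) mod 3"
      using assms(1) by (intro mod_mod_cancel) presburger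
    also have "\<dots> = j mod 3"
      using assms(2) by (auto elim!: dvdE simp: mult.assoc)
    finally show ?thesis .
  qed
  have parity: "even (fst (p i j) + snd (p i j)) \<longleftrightarrow> even (i + j)" for i j
  proof -
    have "p i j = p (int (fst (p i j))) (int (snd (p i j)))"
      using htg_proj_int[of "fst (p i j)" m "snd (p i j)" n l] proj_verts[of i j]
      by (auto simp: HTG_def)
    from proj_eq_translate(2)[OF this] show ?thesis by simp
  qed
  have f_proj: "f (p i j) = (if even (i + j) then {c (p i j) + 1} else {})" for i j
    by (simp only: f_def parity)
  have ne: "p i j \<noteq> p i' j'" if "even (i + j) \<noteq> even (i' + j')" for i j i' j'
    using that proj_eq_translate(2) by blast
  \<comment> \<open>The heights j + 1, j - 1, j represent all residues modulo 3. The column has no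
    influence on \<open>c\<close>, so s is arbitrary and covers both values of
    \<open>side\<close>.\<close>
  have c3: "{c (p i (j + 1)), c (p i (j - 1)), c (p (i + s) j)} = {0, 1, 2}" for i j s
  proof -
    have "j mod 3 = 0 \<or> j mod 3 = 1 \<or> j mod 3 = 2" by presburger
    then have "int ` {c (p i (j + 1)), c (p i (j - 1)), c (p (i + s) j)} = int ` {0, 1, 2}"
      unfolding image_insert image_empty c
      by (elim disjE) (auto simp: mod_simps, presburger+)
    then show ?thesis by (subst (asm) inj_image_eq_iff) auto
  qed
  have cubic: "cubic_graph X"
    unfolding cubic_graph_def finite_simple_graph_def
  proof (intro conjI ballI)
    show "finite (uverts X)" by (simp add: HTG_def)
    fix e assume "e \<in> uedges X"
    \<comment> \<open>Every edge changes the parity of i + j, which excludes loops.\<close>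
    then obtain i j i' j' where "e = {p i j, p i' j'}" "even (i + j) \<noteq> even (i' + j')"
      unfolding edge_iff by (metis even_add odd_one)
    then show "e \<subseteq> uverts X" "card e = 2"
      using proj_verts ne by auto
  next
    fix v assume "v \<in> uverts X"
    then obtain i j where v: "v = p i j" by (rule vertsE)
    have "c ` open_nbhd X v = {0, 1, 2}"
      using c3 by (simp add: v nbhd_proj)
    then have "3 \<le> card (open_nbhd X v)"
      using card_image_le[of "open_nbhd X v" c] by (simp add: v nbhd_proj)
    moreover have "card (open_nbhd X v) \<le> 3"
      by (simp add: v nbhd_proj card_insert_if)
    ultimately show "card (open_nbhd X v) = 3" by simp
  qed
  have "is_3RDF X f"
    unfolding is_3RDF_def
  proof (intro conjI ballI impI)
    fix v
    have "c v \<in> {0, 1, 2}" by (auto simp: c_def)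
    then show "f v \<subseteq> {1, 2, 3}" by (auto simp: f_def)
  next
    fix v assume "v \<in> uverts X" and empty: "f v = {}"
    then obtain i j where v: "v = p i j" by (blast elim: vertsE)
    have odd: "odd (i + j)" using empty by (auto simp: v f_proj split: if_splits)
    have "f u = {c u + 1}" if "u \<in> open_nbhd X v" for u
      using that odd by (auto simp: v nbhd_proj f_proj side_def)
    then have "(\<Union>u\<in>open_nbhd X v. f u) = (\<lambda>x. x + 1) ` c ` open_nbhd X v" by auto
    also have "c ` open_nbhd X v = {0, 1, 2}" using c3 by (simp add: v nbhd_proj)
    finally show "(\<Union>u\<in>open_nbhd X v. f u) = {1, 2, 3}" by auto
  qed
  moreover have "card (uverts X) = 2 * rdf_weight X f"
  proof -
    have "rdf_weight X f = (\<Sum>(i, j)\<in>{0..<m} \<times> {0..<n}. if even (i + j) then 1 else 0)"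
      unfolding rdf_weight_def HTG_def by (auto intro!: sum.cong simp: f_def)
    also have "\<dots> = (\<Sum>i<m. \<Sum>j\<in>{0..<n}. if even (i + j) then 1 else 0)"
      by (simp add: sum.cartesian_product atLeast0LessThan)
    also have "\<dots> = (\<Sum>i<m. n div 2)"
      using card_even_interval by (simp add: sum.If_cases Int_def)
    finally show ?thesis using even_n by (simp add: HTG_def)
  qed
  ultimately show ?thesis using cubic by (auto simp: is_3RDR_iff)
qed

end

theorem theorem4p5:
  fixes m n l :: nat
  assumes "m \<ge> 1" and "n \<ge> 4" and "even n"
    and "l \<le> n div 2" and "[l = m] (mod 2)"
  shows "is_3RDR (HTG m n l) \<longleftrightarrow>
    (even m \<and> [n = 0] (mod 6) \<and> [l = 0] (mod 6)) \<or>
    (odd m \<and> [n = 0] (mod 6) \<and> [l = 3] (mod 6))"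
proof -
  interpret htg m n l using assms by unfold_locales
  have "is_3RDR (HTG m n l) \<longleftrightarrow> 6 dvd n \<and> 3 dvd l"
    using divisible_if_3RDR is_3RDR_if_divisible dvd_trans[of 3 6 n] by auto
  moreover have "6 dvd n \<longleftrightarrow> [n = 0] (mod 6)" by (simp add: cong_0_iff)
  \<comment> \<open>A multiple of 3 is 0 or 3 modulo 6 according to its parity, and the parity of l
    is that of m.\<close>
  moreover have "3 dvd l \<longleftrightarrow> even l \<and> [l = 0] (mod 6) \<or> odd l \<and> [l = 3] (mod 6)"
    unfolding cong_def by presburger
  ultimately show ?thesis unfolding parity_l by blast
qed

end
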